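(* Let $W$ be a finite irreducible Coxeter group with a fixed Coxeter element $c$, such that the only periodic orbit of $\mathsf{Pop}_T(\cdot,c)$ is $\{e\}$. For $w\in W$, set $w_1=w$ and $w_i=\mathsf{Pop}_T(w_{i-1},c)$ for $i\ge 2$, and let $k=|O_{\mathsf{Pop}_T}(w)|-1$ (so that, if $w\neq e$, $w_k\neq w_{k+1}=e$). Then each $\pi_T(w_i,c)$ lies in $\mathrm{NC}(W,c)$ and \[w=\pi_T(w_k,c)\,\pi_T(w_{k-1},c)\cdots\pi_T(w_1,c),\] and the assignment $w\mapsto [\pi_T(w_k,c)][\pi_T(w_{k-1},c)]\cdots[\pi_T(w_1,c)]$ is a lift from $W$ to the dual braid monoid of $W$, i.e., a map $W\to M(W,c)$ whose composition with the natural projection $M(W,c)\to W$ is the identity.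
   Context: $W$ has set of simple reflections $S$, set of reflections $T=\{wsw^{-1}: s\in S,\ w\in W\}$, and Coxeter number $h$. $\ell_T(w)$ is the minimum number of reflections whose product is $w$; absolute order: $v\le_T w$ iff $\ell_T(wv^{-1})=\ell_T(w)-\ell_T(v)$. A Coxeter element is a regular element of $W$ of order $h$. $\mathrm{NC}(W,c)=[e,c]$ in absolute order, a lattice with join $\bigvee$. $\pi_T(w,c)=\bigvee_{t\in T,\ t\le_T w} t$ (join in $\mathrm{NC}(W,c)$, empty join $=e$) and $\mathsf{Pop}_T(w,c)=w\,\pi_T(w,c)^{-1}$. An element $x$ is periodic if $\mathsf{Pop}_T^i(x)=x$ for some $i\ge 1$, and a periodic orbit is the forward orbit $O_{\mathsf{Pop}_T}(x)=\{x,\mathsf{Pop}_T(x),\ldots\}$ of a periodic $x$. The dual braid monoid $M(W,c)$ (Bessis) is the monoid generated by symbols $[x]$ for $x\in\mathrm{NC}(W,c)$ subject to the relations $[x][y]=[xy]$ whenever $x,y,xy\in\mathrm{NC}(W,c)$ and $\ell_T(xy)=\ell_T(x)+\ell_T(y)$; the natural projection $M(W,c)\to W$ sends $[x]\mapsto x$. For $w=e$ the product is empty (the identity of $M(W,c)$). *)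

theory Defs
  imports Complex_Main "HOL-Algebra.Algebra"
begin

definition word_prod :: "('a, 'b) monoid_scheme \<Rightarrow> 'a list \<Rightarrow> 'a" where
  "word_prod G xs = foldr (\<lambda>x y. x \<otimes>\<^bsub>G\<^esub> y) xs \<one>\<^bsub>G\<^esub>"


section \<open>Monoids given by generators and relations\<close>

text \<open>A relation \<open>u = v\<close> between words is a pair \<open>(u, v)\<close>;
  \<open>word_cong R\<close> is the congruence on the free monoid generated by \<open>R\<close>.\<close>

inductive word_cong :: "('a list \<times> 'a list) set \<Rightarrow> 'a list \<Rightarrow> 'a list \<Rightarrow> bool"
  for R where
  rel: "(u, v) \<in> R \<Longrightarrow> word_cong R (p @ u @ q) (p @ v @ q)"
| refl: "word_cong R u u"
| sym: "word_cong R u v \<Longrightarrow> word_cong R v u"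
| trans: "word_cong R u v \<Longrightarrow> word_cong R v w \<Longrightarrow> word_cong R u w"

definition word_class :: "'a set \<Rightarrow> ('a list \<times> 'a list) set \<Rightarrow> 'a list \<Rightarrow> 'a list set" where
  "word_class Y R u = {v \<in> lists Y. word_cong R u v}"

definition presented_monoid :: "'a set \<Rightarrow> ('a list \<times> 'a list) set \<Rightarrow> 'a list set monoid" where
  "presented_monoid Y R =
     \<lparr>carrier = word_class Y R ` lists Y,
      monoid.mult = (\<lambda>A B. \<Union>a\<in>A. \<Union>b\<in>B. word_class Y R (a @ b)),
      monoid.one = word_class Y R []\<rparr>"


section \<open>Coxeter groups\<close>

text \<open>The relations \<open>(st)\<^bsup>m(s,t)\<^esup> = 1\<close>, where \<open>m(s,t)\<close> is the order of \<open>st\<close>. For \<open>s = t\<close> this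
  is \<open>ss = 1\<close>. The library order is \<open>0\<close> for elements of infinite order, which turns the
  relation into the void \<open>1 = 1\<close>.\<close>

definition coxeter_relations :: "('a, 'b) monoid_scheme \<Rightarrow> 'a set \<Rightarrow> ('a list \<times> 'a list) set" where
  "coxeter_relations G S =
     {(concat (replicate (group.ord G (s \<otimes>\<^bsub>G\<^esub> t)) [s, t]), []) | s t. s \<in> S \<and> t \<in> S}"

text \<open>Since the elements of \<open>S\<close> are involutions, the monoid presentation below is the
  usual group presentation.\<close>

definition coxeter_system :: "('a, 'b) monoid_scheme \<Rightarrow> 'a set \<Rightarrow> bool" where
  "coxeter_system G S \<longleftrightarrow>
     group G \<and> S \<subseteq> carrier G \<and> generate G S = carrier G \<and>
     (\<forall>s\<in>S. s \<noteq> \<one>\<^bsub>G\<^esub> \<and> s \<otimes>\<^bsub>G\<^esub> s = \<one>\<^bsub>G\<^esub>) \<and>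
     (\<forall>u\<in>lists S. word_prod G u = \<one>\<^bsub>G\<^esub> \<longrightarrow> word_cong (coxeter_relations G S) u [])"

definition coxeter_graph :: "('a, 'b) monoid_scheme \<Rightarrow> 'a set \<Rightarrow> ('a \<times> 'a) set" where
  "coxeter_graph G S =
     {(s, t). s \<in> S \<and> t \<in> S \<and> s \<noteq> t \<and> group.ord G (s \<otimes>\<^bsub>G\<^esub> t) \<noteq> 2}"

definition irreducible_coxeter :: "('a, 'b) monoid_scheme \<Rightarrow> 'a set \<Rightarrow> bool" where
  "irreducible_coxeter G S \<longleftrightarrow>
     coxeter_system G S \<and> S \<noteq> {} \<and> (\<forall>s\<in>S. \<forall>t\<in>S. (s, t) \<in> (coxeter_graph G S)\<^sup>*)"

definition reflections :: "('a, 'b) monoid_scheme \<Rightarrow> 'a set \<Rightarrow> 'a set" where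
  "reflections G S = {w \<otimes>\<^bsub>G\<^esub> s \<otimes>\<^bsub>G\<^esub> inv\<^bsub>G\<^esub> w | s w. s \<in> S \<and> w \<in> carrier G}"

text \<open>The Coxeter number is the order of the product of all simple reflections, which for a
  finite irreducible Coxeter group does not depend on the order of the factors.\<close>

definition coxeter_number :: "('a, 'b) monoid_scheme \<Rightarrow> 'a set \<Rightarrow> nat" where
  "coxeter_number G S =
     (THE h. \<forall>xs. distinct xs \<and> set xs = S \<longrightarrow> group.ord G (word_prod G xs) = h)"


section \<open>The reflection representation and regular elements\<close>

text \<open>Complexified reflection representation: the space with basis \<open>\<alpha>\<^sub>s\<close> for \<open>s \<in> S\<close>, a vector
  being given by its coordinate function, which vanishes outside \<open>S\<close>. The form is
  \<open>B(\<alpha>\<^sub>s, \<alpha>\<^sub>t) = - cos (\<pi> / m(s,t))\<close>; for \<open>m(s,t) = \<infinity>\<close> (library order \<open>0\<close>) the formula gives the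
  usual value \<open>-1\<close> because of \<open>\<pi> / 0 = 0\<close>.\<close>

definition refl_space :: "'a set \<Rightarrow> ('a \<Rightarrow> complex) set" where
  "refl_space S = {v. \<forall>s. s \<notin> S \<longrightarrow> v s = 0}"

definition coxeter_form :: "('a, 'b) monoid_scheme \<Rightarrow> 'a \<Rightarrow> 'a \<Rightarrow> real" where
  "coxeter_form G s t = - cos (pi / real (group.ord G (s \<otimes>\<^bsub>G\<^esub> t)))"

text \<open>\<open>v \<mapsto> v - 2 B(\<alpha>\<^sub>s, v) \<alpha>\<^sub>s\<close>\<close>

definition simple_refl ::
  "('a, 'b) monoid_scheme \<Rightarrow> 'a set \<Rightarrow> 'a \<Rightarrow> ('a \<Rightarrow> complex) \<Rightarrow> ('a \<Rightarrow> complex)" where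
  "simple_refl G S s v =
     v(s := v s - 2 * (\<Sum>t\<in>S. complex_of_real (coxeter_form G s t) * v t))"

text \<open>The maps \<open>simple_refl G S s\<close> satisfy the Coxeter relations, so in a Coxeter system the
  action of \<open>w\<close> does not depend on the chosen word.\<close>

definition refl_rep ::
  "('a, 'b) monoid_scheme \<Rightarrow> 'a set \<Rightarrow> 'a \<Rightarrow> ('a \<Rightarrow> complex) \<Rightarrow> ('a \<Rightarrow> complex)" where
  "refl_rep G S w =
     foldr (simple_refl G S) (SOME xs. xs \<in> lists S \<and> word_prod G xs = w)"

definition reflecting_hyperplane ::
  "('a, 'b) monoid_scheme \<Rightarrow> 'a set \<Rightarrow> 'a \<Rightarrow> ('a \<Rightarrow> complex) set" where
  "reflecting_hyperplane G S t = {v \<in> refl_space S. refl_rep G S t v = v}"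

text \<open>Regularity in the sense of Springer: some eigenvector lies on no reflecting hyperplane.\<close>

definition regular_element :: "('a, 'b) monoid_scheme \<Rightarrow> 'a set \<Rightarrow> 'a \<Rightarrow> bool" where
  "regular_element G S w \<longleftrightarrow> w \<in> carrier G \<and>
     (\<exists>v\<in>refl_space S. v \<noteq> (\<lambda>_. 0) \<and>
        (\<exists>\<zeta>. refl_rep G S w v = (\<lambda>s. \<zeta> * v s)) \<and>
        (\<forall>t\<in>reflections G S. v \<notin> reflecting_hyperplane G S t))"

definition coxeter_element :: "('a, 'b) monoid_scheme \<Rightarrow> 'a set \<Rightarrow> 'a \<Rightarrow> bool" where
  "coxeter_element G S c \<longleftrightarrow>
     regular_element G S c \<and> group.ord G c = coxeter_number G S"


section \<open>Absolute order and noncrossing partitions\<close>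

definition abs_length :: "('a, 'b) monoid_scheme \<Rightarrow> 'a set \<Rightarrow> 'a \<Rightarrow> nat" where
  "abs_length G S w =
     (LEAST n. \<exists>ts\<in>lists (reflections G S). length ts = n \<and> word_prod G ts = w)"

definition abs_le :: "('a, 'b) monoid_scheme \<Rightarrow> 'a set \<Rightarrow> 'a \<Rightarrow> 'a \<Rightarrow> bool" where
  "abs_le G S v w \<longleftrightarrow>
     int (abs_length G S (w \<otimes>\<^bsub>G\<^esub> inv\<^bsub>G\<^esub> v)) = int (abs_length G S w) - int (abs_length G S v)"

definition NC :: "('a, 'b) monoid_scheme \<Rightarrow> 'a set \<Rightarrow> 'a \<Rightarrow> 'a set" where
  "NC G S c = {x \<in> carrier G. abs_le G S \<one>\<^bsub>G\<^esub> x \<and> abs_le G S x c}"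

definition NC_order :: "('a, 'b) monoid_scheme \<Rightarrow> 'a set \<Rightarrow> 'a \<Rightarrow> 'a gorder" where
  "NC_order G S c = \<lparr>carrier = NC G S c, eq = (=), le = abs_le G S\<rparr>"

text \<open>For a Coxeter element \<open>c\<close> the poset \<open>NC(W,c)\<close> is a lattice (Bessis; Brady and Watt) with
  top element \<open>c\<close>, so least upper bounds exist. The value \<open>c\<close> in the other case only makes
  the definition total; it is never taken when \<open>c\<close> is a Coxeter element.\<close>

definition NC_join :: "('a, 'b) monoid_scheme \<Rightarrow> 'a set \<Rightarrow> 'a \<Rightarrow> 'a set \<Rightarrow> 'a" where
  "NC_join G S c Y =
     (if \<exists>x. least (NC_order G S c) x (Upper (NC_order G S c) Y)
      then \<Squnion>\<^bsub>NC_order G S c\<^esub> Y else c)"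


section \<open>The operator Pop\<close>

definition pi_T :: "('a, 'b) monoid_scheme \<Rightarrow> 'a set \<Rightarrow> 'a \<Rightarrow> 'a \<Rightarrow> 'a" where
  "pi_T G S c w = NC_join G S c {t \<in> reflections G S. abs_le G S t w}"

definition Pop_T :: "('a, 'b) monoid_scheme \<Rightarrow> 'a set \<Rightarrow> 'a \<Rightarrow> 'a \<Rightarrow> 'a" where
  "Pop_T G S c w = w \<otimes>\<^bsub>G\<^esub> inv\<^bsub>G\<^esub> (pi_T G S c w)"

definition forward_orbit :: "('a \<Rightarrow> 'a) \<Rightarrow> 'a \<Rightarrow> 'a set" where
  "forward_orbit f x = {(f ^^ i) x | i. True}"

definition periodic :: "('a \<Rightarrow> 'a) \<Rightarrow> 'a \<Rightarrow> bool" where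
  "periodic f x \<longleftrightarrow> (\<exists>i\<ge>1. (f ^^ i) x = x)"

definition periodic_orbits :: "('a, 'b) monoid_scheme \<Rightarrow> 'a set \<Rightarrow> 'a \<Rightarrow> 'a set set" where
  "periodic_orbits G S c =
     {forward_orbit (Pop_T G S c) x | x. x \<in> carrier G \<and> periodic (Pop_T G S c) x}"

text \<open>The sequence \<open>w\<^sub>1 = w\<close>, \<open>w\<^sub>i = Pop\<^sub>T(w\<^sub>i\<^sub>-\<^sub>1, c)\<close>; only indices \<open>i \<ge> 1\<close> are meaningful.\<close>

definition Pop_seq :: "('a, 'b) monoid_scheme \<Rightarrow> 'a set \<Rightarrow> 'a \<Rightarrow> 'a \<Rightarrow> nat \<Rightarrow> 'a" where
  "Pop_seq G S c w i = (Pop_T G S c ^^ (i - 1)) w"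

definition Pop_steps :: "('a, 'b) monoid_scheme \<Rightarrow> 'a set \<Rightarrow> 'a \<Rightarrow> 'a \<Rightarrow> nat" where
  "Pop_steps G S c w = card (forward_orbit (Pop_T G S c) w) - 1"

text \<open>The word \<open>\<pi>\<^sub>T(w\<^sub>k,c), \<dots>, \<pi>\<^sub>T(w\<^sub>1,c)\<close>, where \<open>k = Pop_steps G S c w\<close>.\<close>

definition Pop_word :: "('a, 'b) monoid_scheme \<Rightarrow> 'a set \<Rightarrow> 'a \<Rightarrow> 'a \<Rightarrow> 'a list" where
  "Pop_word G S c w =
     map (\<lambda>i. pi_T G S c (Pop_seq G S c w i)) (rev [1..<Suc (Pop_steps G S c w)])"


section \<open>The dual braid monoid\<close>

definition dual_braid_relations ::
  "('a, 'b) monoid_scheme \<Rightarrow> 'a set \<Rightarrow> 'a \<Rightarrow> ('a list \<times> 'a list) set" where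
  "dual_braid_relations G S c =
     {([x, y], [x \<otimes>\<^bsub>G\<^esub> y]) | x y.
        x \<in> NC G S c \<and> y \<in> NC G S c \<and> x \<otimes>\<^bsub>G\<^esub> y \<in> NC G S c \<and>
        abs_length G S (x \<otimes>\<^bsub>G\<^esub> y) = abs_length G S x + abs_length G S y}"

definition dual_braid_monoid ::
  "('a, 'b) monoid_scheme \<Rightarrow> 'a set \<Rightarrow> 'a \<Rightarrow> 'a list set monoid" where
  "dual_braid_monoid G S c = presented_monoid (NC G S c) (dual_braid_relations G S c)"

definition dual_braid_gen :: "('a, 'b) monoid_scheme \<Rightarrow> 'a set \<Rightarrow> 'a \<Rightarrow> 'a \<Rightarrow> 'a list set" where
  "dual_braid_gen G S c x = word_class (NC G S c) (dual_braid_relations G S c) [x]"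

text \<open>All words in a class have the same product in the group; this is the homomorphism with
  \<open>[x] \<mapsto> x\<close> (lemmas \<open>natural_projection_hom\<close>, \<open>natural_projection_one\<close> and
  \<open>natural_projection_gen\<close> below).\<close>

definition natural_projection :: "('a, 'b) monoid_scheme \<Rightarrow> 'a list set \<Rightarrow> 'a" where
  "natural_projection G A = the_elem (word_prod G ` A)"

definition Pop_lift :: "('a, 'b) monoid_scheme \<Rightarrow> 'a set \<Rightarrow> 'a \<Rightarrow> 'a \<Rightarrow> 'a list set" where
  "Pop_lift G S c w =
     word_prod (dual_braid_monoid G S c) (map (dual_braid_gen G S c) (Pop_word G S c w))"


section \<open>Presented monoids are monoids, and the projection is a homomorphism\<close>

lemma word_cong_append_left: "word_cong R u v \<Longrightarrow> word_cong R (p @ u) (p @ v)"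
proof (induction rule: word_cong.induct)
  case (rel u v p' q)
  then show ?case using word_cong.rel[of u v R "p @ p'" q] by simp
qed (auto intro: word_cong.intros)

lemma word_cong_append_right: "word_cong R u v \<Longrightarrow> word_cong R (u @ q) (v @ q)"
proof (induction rule: word_cong.induct)
  case (rel u v p q')
  then show ?case using word_cong.rel[of u v R p "q' @ q"] by simp
qed (auto intro: word_cong.intros)

lemma word_cong_append:
  "word_cong R u v \<Longrightarrow> word_cong R u' v' \<Longrightarrow> word_cong R (u @ u') (v @ v')"
  by (meson word_cong.trans word_cong_append_left word_cong_append_right)

lemma word_class_self: "u \<in> lists Y \<Longrightarrow> u \<in> word_class Y R u"
  by (simp add: word_class_def word_cong.refl)

lemma word_class_eqI: "word_cong R u v \<Longrightarrow> word_class Y R u = word_class Y R v"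
  unfolding word_class_def by (blast intro: word_cong.sym word_cong.trans)

lemma word_class_mult:
  assumes "u \<in> lists Y" "v \<in> lists Y"
  shows "word_class Y R u \<otimes>\<^bsub>presented_monoid Y R\<^esub> word_class Y R v = word_class Y R (u @ v)"
proof -
  have "word_class Y R (a @ b) = word_class Y R (u @ v)"
    if "a \<in> word_class Y R u" "b \<in> word_class Y R v" for a b
    using that
    by (intro word_class_eqI word_cong_append) (auto simp: word_class_def intro: word_cong.sym)
  moreover have "u \<in> word_class Y R u" "v \<in> word_class Y R v"
    using assms by (simp_all add: word_class_self)
  ultimately have "(\<Union>a\<in>word_class Y R u. \<Union>b\<in>word_class Y R v. word_class Y R (a @ b))
      = word_class Y R (u @ v)"
    by blast
  then show ?thesis by (simp add: presented_monoid_def)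
qed

lemma monoid_presented_monoid: "monoid (presented_monoid Y R)"
proof (rule monoidI)
  let ?M = "presented_monoid Y R"
  have car: "carrier ?M = word_class Y R ` lists Y" and one: "\<one>\<^bsub>?M\<^esub> = word_class Y R []"
    by (simp_all add: presented_monoid_def)
  show "\<one>\<^bsub>?M\<^esub> \<in> carrier ?M"
    by (simp add: car one)
  show "x \<otimes>\<^bsub>?M\<^esub> y \<in> carrier ?M" if "x \<in> carrier ?M" "y \<in> carrier ?M" for x y
    using that unfolding car
    by (elim imageE) (simp only: word_class_mult imageI append_in_lists_conv simp_thms)
  show "x \<otimes>\<^bsub>?M\<^esub> y \<otimes>\<^bsub>?M\<^esub> z = x \<otimes>\<^bsub>?M\<^esub> (y \<otimes>\<^bsub>?M\<^esub> z)"
    if xyz: "x \<in> carrier ?M" "y \<in> carrier ?M" "z \<in> carrier ?M" for x y z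
  proof -
    obtain a b d where "a \<in> lists Y" "b \<in> lists Y" "d \<in> lists Y"
      and "x = word_class Y R a" "y = word_class Y R b" "z = word_class Y R d"
      using xyz by (auto simp: car)
    then show ?thesis by (simp add: word_class_mult append_in_lists_conv)
  qed
  show "\<one>\<^bsub>?M\<^esub> \<otimes>\<^bsub>?M\<^esub> x = x" if "x \<in> carrier ?M" for x
    using that unfolding car one
    by (elim imageE) (simp only: word_class_mult lists.Nil append_Nil append_Nil2)
  show "x \<otimes>\<^bsub>?M\<^esub> \<one>\<^bsub>?M\<^esub> = x" if "x \<in> carrier ?M" for x
    using that unfolding car one
    by (elim imageE) (simp only: word_class_mult lists.Nil append_Nil append_Nil2)
qed

context group
begin

lemma word_prod_closed: "u \<in> lists (carrier G) \<Longrightarrow> word_prod G u \<in> carrier G"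
  by (induction u) (auto simp: word_prod_def)

lemma word_prod_append:
  "u \<in> lists (carrier G) \<Longrightarrow> v \<in> lists (carrier G) \<Longrightarrow>
    word_prod G (u @ v) = word_prod G u \<otimes> word_prod G v"
proof (induction u)
  case Nil
  then show ?case using word_prod_closed[of v] by (simp add: word_prod_def)
next
  case (Cons a u)
  then show ?case
    using word_prod_closed[of v] word_prod_closed[of u] by (simp add: word_prod_def m_assoc)
qed

lemma NC_subset: "NC G S c \<subseteq> carrier G"
  by (auto simp: NC_def)

lemma word_cong_dual_braid:
  "word_cong (dual_braid_relations G S c) u v \<Longrightarrow>
    (u \<in> lists (NC G S c) \<longleftrightarrow> v \<in> lists (NC G S c)) \<and>
    (u \<in> lists (NC G S c) \<longrightarrow> word_prod G u = word_prod G v)"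
proof (induction rule: word_cong.induct)
  case (rel u v p q)
  then obtain x y where uv: "u = [x, y]" "v = [x \<otimes> y]"
    and xy: "x \<in> NC G S c" "y \<in> NC G S c" "x \<otimes> y \<in> NC G S c"
    by (auto simp: dual_braid_relations_def)
  have "word_prod G (p @ u @ q) = word_prod G (p @ v @ q)"
    if "p \<in> lists (NC G S c)" "q \<in> lists (NC G S c)"
  proof -
    have "p \<in> lists (carrier G)" "q \<in> lists (carrier G)"
      and "x \<in> carrier G" "y \<in> carrier G"
      using that xy NC_subset by blast+
    moreover have "word_prod G (u @ q) = word_prod G (v @ q)"
      using calculation word_prod_closed[of q] by (simp add: uv word_prod_def m_assoc)
    moreover have "u @ q \<in> lists (carrier G)" "v @ q \<in> lists (carrier G)"
      using calculation by (simp_all add: uv)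
    ultimately show ?thesis by (simp only: word_prod_append)
  qed
  then show ?case using uv xy by auto
qed auto

lemma natural_projection_word_class:
  assumes u: "u \<in> lists (NC G S c)"
  shows "natural_projection G (word_class (NC G S c) (dual_braid_relations G S c) u)
    = word_prod G u"
proof -
  let ?C = "word_class (NC G S c) (dual_braid_relations G S c) u"
  have "u \<in> ?C" using u by (rule word_class_self)
  moreover have "word_prod G v = word_prod G u" if "v \<in> ?C" for v
    using that u word_cong_dual_braid[of S c u v] by (auto simp: word_class_def)
  ultimately have "word_prod G ` ?C = {word_prod G u}" by blast
  then show ?thesis by (simp add: natural_projection_def)
qed

lemma natural_projection_hom: "natural_projection G \<in> hom (dual_braid_monoid G S c) G"
proof -
  have sub: "lists (NC G S c) \<subseteq> lists (carrier G)"
    using NC_subset by (rule lists_mono)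
  show ?thesis
    unfolding hom_def dual_braid_monoid_def
  proof (safe)
    fix A assume "A \<in> carrier (presented_monoid (NC G S c) (dual_braid_relations G S c))"
    then obtain u where "u \<in> lists (NC G S c)"
      "A = word_class (NC G S c) (dual_braid_relations G S c) u"
      by (auto simp: presented_monoid_def)
    then show "natural_projection G A \<in> carrier G"
      using sub by (auto simp: natural_projection_word_class intro!: word_prod_closed)
  next
    fix A B
    assume "A \<in> carrier (presented_monoid (NC G S c) (dual_braid_relations G S c))"
      "B \<in> carrier (presented_monoid (NC G S c) (dual_braid_relations G S c))"
    then obtain u v where "u \<in> lists (NC G S c)" "v \<in> lists (NC G S c)"
      "A = word_class (NC G S c) (dual_braid_relations G S c) u"
      "B = word_class (NC G S c) (dual_braid_relations G S c) v"
      by (auto simp: presented_monoid_def)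
    moreover have "u @ v \<in> lists (NC G S c)" using calculation by simp
    moreover have "word_prod G (u @ v) = word_prod G u \<otimes> word_prod G v"
      using calculation sub by (intro word_prod_append) blast+
    ultimately show "natural_projection G
        (A \<otimes>\<^bsub>presented_monoid (NC G S c) (dual_braid_relations G S c)\<^esub> B)
      = natural_projection G A \<otimes> natural_projection G B"
      by (simp only: word_class_mult natural_projection_word_class)
  qed
qed

lemma natural_projection_one: "natural_projection G \<one>\<^bsub>dual_braid_monoid G S c\<^esub> = \<one>"
  using natural_projection_word_class[of "[]" S c]
  by (simp add: dual_braid_monoid_def presented_monoid_def word_prod_def)

lemma natural_projection_gen:
  "x \<in> NC G S c \<Longrightarrow> natural_projection G (dual_braid_gen G S c x) = x"
  using natural_projection_word_class[of "[x]" S c] NC_subset[of S c]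
  by (auto simp: dual_braid_gen_def word_prod_def)

end

end

theory Submission
  imports Defs
begin

text \<open>In a finite set every orbit reaches a periodic point, so \<open>Pop\<^sub>T\<close> eventually takes \<open>w\<close> to \<open>e\<close>,
  and the first \<open>k\<close> with \<open>Pop\<^sub>T\<^sup>k(w) = e\<close> is one less than the size of the orbit. The product
  formula telescopes from \<open>w = Pop\<^sub>T(w) \<pi>\<^sub>T(w)\<close>. That \<open>Pop\<^sub>T(e) = e\<close> comes for free: \<open>{e}\<close> is
  assumed to be an orbit.\<close>

lemma funpow_fixpoint: "f x = x \<Longrightarrow> (f ^^ n) x = x"
  by (induction n) auto

lemma funpow_in_set: "f \<in> A \<rightarrow> A \<Longrightarrow> x \<in> A \<Longrightarrow> (f ^^ n) x \<in> A"
  by (induction n) (simp_all add: Pi_iff)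

text \<open>Applying \<open>f\<close> another \<open>j - i\<close> times to the earlier of two equal
  iterates returns to it, and \<open>i < j\<close> makes this exponent at least 1.\<close>

lemma periodic_of_funpow_eq:
  assumes "(f ^^ i) x = (f ^^ j) x" "i < j"
  shows "periodic f ((f ^^ i) x)"
proof -
  have "(f ^^ (j - i)) ((f ^^ i) x) = (f ^^ (j - i + i)) x"
    by (simp add: funpow_add)
  also have "\<dots> = (f ^^ i) x"
    using assms by simp
  finally show ?thesis
    using assms(2) unfolding periodic_def by (intro exI[of _ "j - i"]) simp
qed

text \<open>Pigeonhole: infinitely many exponents and finitely many values force two iterates to
  coincide, and the earlier of them is periodic.\<close>

lemma ex_funpow_periodic:
  assumes "finite A" "f \<in> A \<rightarrow> A" "x \<in> A"
  shows "\<exists>n. periodic f ((f ^^ n) x)"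
proof -
  have "range (\<lambda>n. (f ^^ n) x) \<subseteq> A"
    using funpow_in_set[OF assms(2,3)] by blast
  then have "\<not> inj (\<lambda>n. (f ^^ n) x)"
    using assms(1) finite_subset range_inj_infinite by blast
  then obtain i j where "(f ^^ i) x = (f ^^ j) x" "i < j"
    using linorder_injI[of "\<lambda>n. (f ^^ n) x"] by blast
  then show ?thesis
    by (intro exI periodic_of_funpow_eq)
qed

text \<open>Let \<open>n\<close> be the first exponent that reaches \<open>e\<close>. A repetition
  among the iterates \<open>0, ..., n\<close> would be periodic, hence equal to \<open>e\<close>,
  before \<open>n\<close>; from \<open>n\<close> on the iterates stay at \<open>e\<close>. So the
  orbit has exactly \<open>n + 1\<close> points.\<close>

lemma card_forward_orbit:
  assumes "finite A" "f \<in> A \<rightarrow> A" "x \<in> A" "f e = e"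
    and periodic_e: "\<And>y. y \<in> A \<Longrightarrow> periodic f y \<Longrightarrow> y = e"
  shows "card (forward_orbit f x) = Suc (LEAST n. (f ^^ n) x = e)"
    and "(f ^^ (LEAST n. (f ^^ n) x = e)) x = e"
proof -
  define n where "n = (LEAST n. (f ^^ n) x = e)"
  have in_A: "(f ^^ i) x \<in> A" for i
    using funpow_in_set[OF assms(2,3)] .
  have "\<exists>n. (f ^^ n) x = e"
    using ex_funpow_periodic[OF assms(1-3)] periodic_e in_A by blast
  then have n: "(f ^^ n) x = e"
    unfolding n_def by (rule LeastI_ex)
  have fixed: "(f ^^ i) x = e" if "n \<le> i" for i
  proof -
    have "(f ^^ (i - n + n)) x = (f ^^ (i - n)) ((f ^^ n) x)"
      by (simp only: funpow_add comp_apply)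
    then show ?thesis
      using that by (simp add: n funpow_fixpoint assms(4))
  qed
  have "(f ^^ i) x \<noteq> (f ^^ j) x" if "i < j" "j \<le> n" for i j
  proof
    assume "(f ^^ i) x = (f ^^ j) x"
    then have "(f ^^ i) x = e"
      using \<open>i < j\<close> by (intro periodic_e in_A periodic_of_funpow_eq)
    then have "n \<le> i"
      unfolding n_def by (rule Least_le)
    then show False
      using that by simp
  qed
  then have "inj_on (\<lambda>i. (f ^^ i) x) {..n}"
    by (intro linorder_inj_onI) auto
  moreover have "forward_orbit f x = (\<lambda>i. (f ^^ i) x) ` {..n}"
  proof
    \<comment> \<open>Capping the exponent at \<open>n\<close> gives a witness in
      \<open>{..n}\<close> for each point of the orbit.\<close>
    have "(f ^^ i) x = (f ^^ min i n) x" for i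
      by (simp add: min_def fixed n)
    then show "forward_orbit f x \<subseteq> (\<lambda>i. (f ^^ i) x) ` {..n}"
      unfolding forward_orbit_def using min.cobounded2 by fast
  qed (auto simp: forward_orbit_def)
  ultimately show "card (forward_orbit f x) = Suc (LEAST n. (f ^^ n) x = e)"
    by (simp add: card_image n_def)
  show "(f ^^ (LEAST n. (f ^^ n) x = e)) x = e"
    using n by (simp add: n_def)
qed

text \<open>This turns the lift, defined as a product of generator classes, into the class of a
  single word, to which the projection can be applied.\<close>

lemma word_prod_presented_monoid:
  "u \<in> lists Y \<Longrightarrow>
    word_prod (presented_monoid Y R) (map (\<lambda>y. word_class Y R [y]) u) = word_class Y R u"
proof (induction u)
  case Nil
  then show ?case by (simp add: word_prod_def presented_monoid_def)
next
  case (Cons y u)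
  then have "word_prod (presented_monoid Y R) (map (\<lambda>y. word_class Y R [y]) (y # u))
      = word_class Y R [y] \<otimes>\<^bsub>presented_monoid Y R\<^esub> word_class Y R u"
    by (simp add: word_prod_def)
  also have "\<dots> = word_class Y R (y # u)"
    using Cons.prems word_class_mult[of "[y]" Y u R] by simp
  finally show ?case .
qed

lemma Pop_lift_eq_word_class:
  "Pop_word G S c w \<in> lists (NC G S c) \<Longrightarrow>
    Pop_lift G S c w = word_class (NC G S c) (dual_braid_relations G S c) (Pop_word G S c w)"
  by (simp add: Pop_lift_def dual_braid_monoid_def dual_braid_gen_def[abs_def]
      word_prod_presented_monoid)

context group
begin

lemma abs_length_one: "abs_length G S \<one> = 0"
proof -
  have "\<exists>ts\<in>lists (reflections G S). length ts = 0 \<and> word_prod G ts = \<one>"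
    by (intro bexI[of _ "[]"]) (auto simp: word_prod_def)
  then show ?thesis
    unfolding abs_length_def by (rule Least_eq_0)
qed

lemma top_in_NC: "c \<in> carrier G \<Longrightarrow> c \<in> NC G S c"
  by (simp add: NC_def abs_le_def abs_length_one)

text \<open>Both branches of \<open>NC_join\<close> stay in \<open>NC G S c\<close>: an upper bound
  is by definition an element of the poset, and the default value is \<open>c\<close>
  itself.\<close>

lemma pi_T_in_NC:
  assumes "c \<in> carrier G"
  shows "pi_T G S c w \<in> NC G S c"
proof (cases "\<exists>x. least (NC_order G S c) x
    (Upper (NC_order G S c) {t \<in> reflections G S. abs_le G S t w})")
  case True
  \<comment> \<open>The library join is a choice of some least upper bound, so existence makes the
    chosen element one.\<close>
  then have "pi_T G S c w \<in> Upper (NC_order G S c) {t \<in> reflections G S. abs_le G S t w}"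
    by (auto simp: pi_T_def NC_join_def sup_def least_def intro: someI2_ex)
  then show ?thesis
    by (simp add: Upper_def NC_order_def)
next
  case False
  then show ?thesis
    using top_in_NC[OF assms] by (simp add: pi_T_def NC_join_def)
qed

lemma pi_T_closed: "c \<in> carrier G \<Longrightarrow> pi_T G S c w \<in> carrier G"
  by (rule subsetD[OF NC_subset pi_T_in_NC])

lemma Pop_T_closed: "c \<in> carrier G \<Longrightarrow> Pop_T G S c \<in> carrier G \<rightarrow> carrier G"
  by (auto simp: Pop_T_def pi_T_closed)

lemma Pop_T_mult_pi_T:
  "c \<in> carrier G \<Longrightarrow> w \<in> carrier G \<Longrightarrow> Pop_T G S c w \<otimes> pi_T G S c w = w"
  by (simp add: Pop_T_def pi_T_closed m_assoc)

text \<open>The untreated rest of \<open>w\<close> stands on the left. Each step splits it as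
  \<open>Pop_T\<close> of it times \<open>pi_T\<close> of it, and the new factor joins the word at
  its front.\<close>

lemma Pop_telescope:
  assumes "c \<in> carrier G" "w \<in> carrier G"
  shows "(Pop_T G S c ^^ n) w \<otimes>
      word_prod G (map (\<lambda>i. pi_T G S c (Pop_seq G S c w i)) (rev [1..<Suc n])) = w"
proof (induction n)
  case 0
  then show ?case using assms by (simp add: word_prod_def)
next
  case (Suc n)
  let ?x = "(Pop_T G S c ^^ n) w"
  let ?p = "word_prod G (map (\<lambda>i. pi_T G S c (Pop_seq G S c w i)) (rev [1..<Suc n]))"
  have x: "?x \<in> carrier G"
    using Pop_T_closed[OF assms(1)] assms(2) by (rule funpow_in_set)
  have p: "?p \<in> carrier G"
    using assms(1) by (intro word_prod_closed) (auto simp: pi_T_closed)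
  \<comment> \<open>\<open>Pop_seq\<close> counts from 1, so its entry at \<open>Suc n\<close> is
    the iterate \<open>?x\<close>; the reversal puts its factor first.\<close>
  have "word_prod G (map (\<lambda>i. pi_T G S c (Pop_seq G S c w i)) (rev [1..<Suc (Suc n)]))
      = pi_T G S c ?x \<otimes> ?p"
    by (simp add: word_prod_def Pop_seq_def)
  moreover have "Pop_T G S c ?x \<otimes> (pi_T G S c ?x \<otimes> ?p) = ?x \<otimes> ?p"
    using Pop_T_closed[OF assms(1)] x p assms(1)
    by (subst m_assoc[symmetric]) (auto simp: pi_T_closed Pop_T_mult_pi_T)
  ultimately show ?case
    using Suc.IH by simp
qed

lemma Pop_word_in_lists: "c \<in> carrier G \<Longrightarrow> Pop_word G S c w \<in> lists (NC G S c)"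
  by (auto simp: Pop_word_def pi_T_in_NC)

end

theorem theorem8p1:
  fixes G :: "('a, 'b) monoid_scheme" and S :: "'a set" and c :: 'a
  assumes "finite (carrier G)" and "irreducible_coxeter G S" and "coxeter_element G S c"
    and "periodic_orbits G S c = {{\<one>\<^bsub>G\<^esub>}}"
  shows "(\<forall>w\<in>carrier G.
            (w \<noteq> \<one>\<^bsub>G\<^esub> \<longrightarrow>
               1 \<le> Pop_steps G S c w \<and>
               Pop_seq G S c w (Pop_steps G S c w) \<noteq> Pop_seq G S c w (Pop_steps G S c w + 1) \<and>
               Pop_seq G S c w (Pop_steps G S c w + 1) = \<one>\<^bsub>G\<^esub>) \<and>
            (\<forall>i\<ge>1. pi_T G S c (Pop_seq G S c w i) \<in> NC G S c) \<and>
            w = word_prod G (Pop_word G S c w)) \<and>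
         Pop_lift G S c \<in> carrier G \<rightarrow> carrier (dual_braid_monoid G S c) \<and>
         (\<forall>w\<in>carrier G. natural_projection G (Pop_lift G S c w) = w)"
proof -
  interpret group G
    using assms(2) by (simp add: irreducible_coxeter_def coxeter_system_def)
  have c: "c \<in> carrier G"
    using assms(3) by (simp add: coxeter_element_def regular_element_def)
  let ?f = "Pop_T G S c"
  have closed: "?f \<in> carrier G \<rightarrow> carrier G"
    using c by (rule Pop_T_closed)
  have self: "x \<in> forward_orbit ?f x" for x
    unfolding forward_orbit_def by (auto intro: exI[of _ 0])
  have periodic_one: "x = \<one>\<^bsub>G\<^esub>" if "x \<in> carrier G" "periodic ?f x" for x
    using that assms(4) self[of x] by (auto simp: periodic_orbits_def)
  have "{\<one>\<^bsub>G\<^esub>} \<in> periodic_orbits G S c"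
    using assms(4) by simp
  then obtain x where x: "forward_orbit ?f x = {\<one>\<^bsub>G\<^esub>}"
    by (auto simp: periodic_orbits_def)
  then have "x = \<one>\<^bsub>G\<^esub>"
    using self by blast
  moreover have "?f x \<in> forward_orbit ?f x"
    unfolding forward_orbit_def by (auto intro: exI[of _ 1])
  ultimately have fixed: "?f \<one>\<^bsub>G\<^esub> = \<one>\<^bsub>G\<^esub>"
    using x by simp
  \<comment> \<open>The \<open>- 1\<close> in \<open>Pop_steps\<close> cancels the successor in the
    size of the orbit.\<close>
  have steps: "Pop_steps G S c w = (LEAST n. (?f ^^ n) w = \<one>\<^bsub>G\<^esub>)"
    and reach: "(?f ^^ Pop_steps G S c w) w = \<one>\<^bsub>G\<^esub>" if "w \<in> carrier G" for w
    using card_forward_orbit[OF assms(1) closed that fixed periodic_one]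
    by (simp_all add: Pop_steps_def)
  have last: "1 \<le> Pop_steps G S c w \<and>
      Pop_seq G S c w (Pop_steps G S c w) \<noteq> Pop_seq G S c w (Pop_steps G S c w + 1) \<and>
      Pop_seq G S c w (Pop_steps G S c w + 1) = \<one>\<^bsub>G\<^esub>"
    if w: "w \<in> carrier G" "w \<noteq> \<one>\<^bsub>G\<^esub>" for w
  proof -
    have k: "1 \<le> Pop_steps G S c w"
      using reach[OF w(1)] w(2) by (cases "Pop_steps G S c w") auto
    \<comment> \<open>With \<open>k\<close> the number of steps, the \<open>k\<close>-th entry of
      \<open>Pop_seq\<close> is the iterate with exponent \<open>k - 1\<close>, which minimality
      keeps away from the identity.\<close>
    then have "(?f ^^ (Pop_steps G S c w - 1)) w \<noteq> \<one>\<^bsub>G\<^esub>"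
      using steps[OF w(1)] not_less_Least[of "Pop_steps G S c w - 1" "\<lambda>n. (?f ^^ n) w = \<one>\<^bsub>G\<^esub>"]
      by simp
    then show ?thesis
      using k reach[OF w(1)] by (simp add: Pop_seq_def)
  qed
  have prod: "word_prod G (Pop_word G S c w) = w" if "w \<in> carrier G" for w
  proof -
    \<comment> \<open>Membership in the carrier allows the identity left over in front by the
      telescoping to be cancelled.\<close>
    have "word_prod G (Pop_word G S c w) \<in> carrier G"
      using Pop_word_in_lists[OF c] NC_subset lists_mono by (blast intro: word_prod_closed)
    then show ?thesis
      using Pop_telescope[OF c that, where S = S and n = "Pop_steps G S c w"] reach[OF that]
      by (simp add: Pop_word_def del: upt_Suc)
  qed
  have lift: "Pop_lift G S c w
      = word_class (NC G S c) (dual_braid_relations G S c) (Pop_word G S c w)" for w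
    using Pop_word_in_lists[OF c] by (rule Pop_lift_eq_word_class)
  have "Pop_lift G S c \<in> carrier G \<rightarrow> carrier (dual_braid_monoid G S c)"
    using Pop_word_in_lists[OF c] by (auto simp: lift dual_braid_monoid_def presented_monoid_def)
  \<comment> \<open>The projection multiplies out the representative \<open>Pop_word\<close>, whose
    product is \<open>w\<close>.\<close>
  moreover have "natural_projection G (Pop_lift G S c w) = w" if "w \<in> carrier G" for w
    using Pop_word_in_lists[OF c] prod[OF that]
    by (simp add: lift natural_projection_word_class)
  ultimately show ?thesis
    using last prod[symmetric] pi_T_in_NC[OF c] by blast
qed

end
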